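(* Let $X$ be a compact metric space and let $F:X\to 2^X$ be an upper semi-continuous set-valued map with $F(X)=X$. If the shift map $\sigma:\underleftarrow{\lim} F\to\underleftarrow{\lim} F$ is topologically transitive, then $F$ is topologically transitive.
   Context: $\mathbb{N}=\{0,1,2,\dots\}$, $\mathbb{Z}^+=\{1,2,3,\dots\}$. $2^X$ is the set of nonempty closed subsets of $X$. $F:X\to 2^X$ is upper semi-continuous if for every $x\in X$ and every open $V\subset X$ containing $F(x)$ there is an open $U\subset X$ containing $x$ with $F(t)\subset V$ for all $t\in U$. $F(X)=\bigcup_{x\in X}F(x)$. The inverse limit space is $\underleftarrow{\lim} F=\{(x_0,x_1,\dots)\in X^{\mathbb{N}}: x_i\in F(x_{i+1})\ \forall i\ge 0\}$ with the subspace topology from the product $X^{\mathbb{N}}$, and $\sigma(x_0,x_1,\dots)=(x_1,x_2,\dots)$. A continuous map $g:Y\to Y$ on a compact metric space is topologically transitive if for any nonempty open $U,V\subset Y$ there is $n\in\mathbb{Z}^+$ with $g^n(U)\cap V\ne\emptyset$. An orbit of $x\in X$ for $F$ is a sequence $(x_i)_{i=0}^\infty$ with $x_0=x$ and $x_{i+1}\in F(x_i)$ for all $i\ge0$. The set-valued map $F$ is topologically transitive if for any nonempty open $U,V\subset X$ there is $n\in\mathbb{Z}^+$ and a point $x_0\in U$ with an orbit $(x_i)_{i=0}^\infty$ for $F$ satisfying $x_n\in V$. *)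

theory Defs
  imports "HOL-Analysis.Analysis"
begin

text \<open>A space is a topology \<open>T\<close> with carrier \<open>topspace T\<close>. A set-valued map on it is a total
  function \<open>F\<close> on the ambient type; its values outside \<open>topspace T\<close> play no role.\<close>

definition closed_hyperspace :: "'a topology \<Rightarrow> 'a set set" where
  "closed_hyperspace T = {A. closedin T A \<and> A \<noteq> {}}"

definition upper_semicontinuous :: "'a topology \<Rightarrow> ('a \<Rightarrow> 'a set) \<Rightarrow> bool" where
  "upper_semicontinuous T F \<longleftrightarrow>
    (\<forall>x\<in>topspace T. \<forall>V. openin T V \<and> F x \<subseteq> V \<longrightarrow>
      (\<exists>U. openin T U \<and> x \<in> U \<and> (\<forall>t\<in>U. F t \<subseteq> V)))"

definition inverse_limit :: "'a topology \<Rightarrow> ('a \<Rightarrow> 'a set) \<Rightarrow> (nat \<Rightarrow> 'a) topology" where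
  "inverse_limit T F =
    subtopology (product_topology (\<lambda>_. T) UNIV)
      {x. (\<forall>i. x i \<in> topspace T) \<and> (\<forall>i. x i \<in> F (x (Suc i)))}"

definition shift :: "(nat \<Rightarrow> 'a) \<Rightarrow> nat \<Rightarrow> 'a" where
  "shift x = (\<lambda>i. x (Suc i))"

lemma continuous_map_shift:
  "continuous_map (inverse_limit T F) (inverse_limit T F) shift"
  unfolding inverse_limit_def shift_def
  by (auto simp: continuous_map_in_subtopology continuous_map_componentwise_UNIV
      intro!: continuous_map_from_subtopology continuous_map_product_projection)

text \<open>Stated for an arbitrary self-map; for the shift on an inverse limit, continuity holds by
  \<open>continuous_map_shift\<close>.\<close>

definition transitive_map :: "'b topology \<Rightarrow> ('b \<Rightarrow> 'b) \<Rightarrow> bool" where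
  "transitive_map Y g \<longleftrightarrow>
    (\<forall>U V. openin Y U \<and> U \<noteq> {} \<and> openin Y V \<and> V \<noteq> {} \<longrightarrow>
      (\<exists>n>0. (g ^^ n) ` U \<inter> V \<noteq> {}))"

definition is_orbit :: "('a \<Rightarrow> 'a set) \<Rightarrow> 'a \<Rightarrow> (nat \<Rightarrow> 'a) \<Rightarrow> bool" where
  "is_orbit F p x \<longleftrightarrow> x 0 = p \<and> (\<forall>i. x (Suc i) \<in> F (x i))"

definition transitive_set_valued_map :: "'a topology \<Rightarrow> ('a \<Rightarrow> 'a set) \<Rightarrow> bool" where
  "transitive_set_valued_map T F \<longleftrightarrow>
    (\<forall>U V. openin T U \<and> U \<noteq> {} \<and> openin T V \<and> V \<noteq> {} \<longrightarrow>
      (\<exists>n>0. \<exists>p\<in>U. \<exists>x. is_orbit F p x \<and> x n \<in> V))"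

end

theory Submission imports Defs begin

text \<open>A point of the inverse limit, read from a coordinate \<open>n\<close> down to \<open>0\<close>, is a finite orbit
  segment of \<open>F\<close> from its coordinate \<open>n\<close> to its coordinate \<open>0\<close>. Given nonempty open \<open>U\<close> and \<open>V\<close>,
  consider the cylinders of sequences whose coordinate \<open>0\<close> lies in \<open>U\<close>, respectively in \<open>V\<close>. They are
  open, and they are nonempty because surjectivity of \<open>F\<close> makes every point the coordinate \<open>0\<close> of some
  sequence in the inverse limit (lemma \<open>inverse_limit_through\<close>). As the shift moves indices up while
  orbits move them down, transitivity is applied from the cylinder over \<open>V\<close> to the cylinder over \<open>U\<close>:
  it yields a sequence starting in \<open>V\<close> whose coordinate \<open>n\<close> lies in \<open>U\<close>, and hence a segment from \<open>U\<close>
  to \<open>V\<close>. Nonemptiness of the values of \<open>F\<close> prolongs this segment to an infinite orbit (lemma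
  \<open>orbit_from_reversed_segment\<close>).\<close>

lemma funpow_shift: "(shift ^^ n) x = (\<lambda>i. x (i + n))"
  by (induction n) (simp_all add: shift_def)

lemma topspace_inverse_limit:
  "topspace (inverse_limit T F) =
    {x. (\<forall>i. x i \<in> topspace T) \<and> (\<forall>i. x i \<in> F (x (Suc i)))}"
  by (auto simp: inverse_limit_def)

lemma openin_inverse_limit_cylinder:
  assumes "openin T U"
  shows "openin (inverse_limit T F) {x \<in> topspace (inverse_limit T F). x i \<in> U}"
proof -
  have "continuous_map (inverse_limit T F) T (\<lambda>x. x i)"
    unfolding inverse_limit_def
    by (intro continuous_map_from_subtopology continuous_map_product_projection) simp
  then show ?thesis
    using assms by (rule openin_continuous_map_preimage)
qed

lemma inverse_limit_through:
  assumes surj: "topspace T \<subseteq> (\<Union>x\<in>topspace T. F x)"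
    and p: "p \<in> topspace T"
  obtains x where "x \<in> topspace (inverse_limit T F)" "x 0 = p"
proof -
  have "\<exists>x. \<forall>i. (x i \<in> topspace T \<and> (i = 0 \<longrightarrow> x i = p)) \<and> x i \<in> F (x (Suc i))"
    by (rule dependent_nat_choice) (use surj p in auto)
  then show thesis
    using that by (auto simp: topspace_inverse_limit)
qed

lemma orbit_through:
  assumes self: "\<And>x. x \<in> S \<Longrightarrow> F x \<subseteq> S"
    and ne: "\<And>x. x \<in> S \<Longrightarrow> F x \<noteq> {}"
    and p: "p \<in> S"
  obtains x where "is_orbit F p x"
proof -
  have "\<exists>x. \<forall>i. (x i \<in> S \<and> (i = 0 \<longrightarrow> x i = p)) \<and> x (Suc i) \<in> F (x i)"
  proof (rule dependent_nat_choice)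
    show "\<exists>y. (y \<in> S \<and> (Suc i = 0 \<longrightarrow> y = p)) \<and> y \<in> F x"
      if "x \<in> S \<and> (i = 0 \<longrightarrow> x = p)" for x i
      using that self[of x] ne[of x] by auto
  qed (use p in auto)
  then show thesis
    using that by (auto simp: is_orbit_def)
qed

text \<open>An orbit starting at the end \<open>x 0\<close> of the reversed segment can be appended to that segment.\<close>

lemma orbit_from_reversed_segment:
  assumes rev_step: "\<And>i. i < n \<Longrightarrow> x i \<in> F (x (Suc i))"
    and z: "is_orbit F (x 0) z"
  obtains y where "is_orbit F (x n) y" "y n = x 0"
proof
  let ?y = "\<lambda>i. if i \<le> n then x (n - i) else z (i - n)"
  have "?y (Suc i) \<in> F (?y i)" for i
  proof (cases "i < n")
    case True
    then have "n - i = Suc (n - Suc i)"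
      by simp
    with True rev_step[of "n - Suc i"] show ?thesis
      by simp
  next
    case False
    \<comment> \<open>The two pieces agree at the junction \<open>i = n\<close>, so from there on \<open>z\<close> gives every value.\<close>
    have "?y i = z (i - n)"
      using False z by (auto simp: is_orbit_def)
    moreover have "?y (Suc i) = z (Suc (i - n))"
      using False by (simp add: Suc_diff_le)
    ultimately show ?thesis
      using z unfolding is_orbit_def by metis
  qed
  then show "is_orbit F (x n) ?y"
    by (simp add: is_orbit_def)
  show "?y n = x 0"
    by simp
qed

theorem theorem3p6:
  fixes X :: "'a set" and d :: "'a \<Rightarrow> 'a \<Rightarrow> real" and F :: "'a \<Rightarrow> 'a set"
  defines "T \<equiv> Metric_space.mtopology X d"
  assumes "Metric_space X d"
    and "compact_space T"
    and "F \<in> X \<rightarrow> closed_hyperspace T"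
    and "upper_semicontinuous T F"
    and "(\<Union>x\<in>X. F x) = X"
    and "transitive_map (inverse_limit T F) shift"
  shows "transitive_set_valued_map T F"
  unfolding transitive_set_valued_map_def
proof (intro allI impI, elim conjE)
  fix U V
  assume U: "openin T U" "U \<noteq> {}" and V: "openin T V" "V \<noteq> {}"
  have X: "topspace T = X"
    unfolding T_def using assms(2) by (rule Metric_space.topspace_mtopology)
  have surj: "topspace T \<subseteq> (\<Union>x\<in>topspace T. F x)"
    using assms(6) X by simp
  let ?C = "\<lambda>W. {x \<in> topspace (inverse_limit T F). x 0 \<in> W}"
  have nonempty: "?C W \<noteq> {}" if W: "openin T W" "W \<noteq> {}" for W
  proof -
    obtain p where p: "p \<in> W"
      using W(2) by blast
    then have "p \<in> topspace T"
      using openin_subset[OF W(1)] by blast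
    then obtain x where "x \<in> topspace (inverse_limit T F)" "x 0 = p"
      using inverse_limit_through[OF surj] by blast
    with p show ?thesis
      by blast
  qed
  obtain n where n: "n > 0" "(shift ^^ n) ` ?C V \<inter> ?C U \<noteq> {}"
    using assms(7) openin_inverse_limit_cylinder[OF U(1)] nonempty[OF U]
      openin_inverse_limit_cylinder[OF V(1)] nonempty[OF V]
    unfolding transitive_map_def by meson
  then obtain x where x: "x \<in> topspace (inverse_limit T F)" "x 0 \<in> V" "x n \<in> U"
    by (auto simp: funpow_shift)
  have "F p \<subseteq> X" "F p \<noteq> {}" if "p \<in> X" for p
    using that assms(4,6) by (auto simp: closed_hyperspace_def)
  moreover have "x 0 \<in> X"
    using x(1) X by (simp add: topspace_inverse_limit)
  ultimately obtain z where z: "is_orbit F (x 0) z"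
    using orbit_through[of X F "x 0"] by blast
  have "\<And>i. x i \<in> F (x (Suc i))"
    using x(1) by (simp add: topspace_inverse_limit)
  then obtain y where "is_orbit F (x n) y" "y n = x 0"
    using z orbit_from_reversed_segment[of n x F z] by blast
  with n(1) x show "\<exists>n>0. \<exists>p\<in>U. \<exists>y. is_orbit F p y \<and> y n \<in> V"
    by metis
qed

end
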